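(* For every graph $G$, $\frac{\mathrm{bw}(G)}{25} \leq \mathrm{mimw}(L(G)) \leq \mathrm{bw}(G)$.
   Context: All graphs are finite and simple. $L(G)$ is the line graph of $G$ (vertex set $E(G)$, adjacency = sharing an endpoint). For a set $S$ and a function $f:2^S\to\mathbb{Z}$ with $f(X)=f(S\setminus X)$, a branch decomposition on $S$ is a pair $(T,\delta)$ with $T$ a tree of maximum degree at most $3$ and $\delta$ a bijection from $S$ to the leaves of $T$; each edge $e$ of $T$ induces a bipartition $(A_e,\overline{A_e})$ of $S$ via the components of $T-e$. The $f$-branch-width on $S$ is the minimum over all branch decompositions on $S$ of $\max_{e\in E(T)} f(A_e)$ if $|S|\ge 2$, and $f(\emptyset)$ if $|S|\le 1$. Branch-width $\mathrm{bw}(G)$: for $X\subseteq E(G)$, let $\mathrm{mid}(X)$ be the set of vertices incident both with an edge of $X$ and with an edge of $E(G)\setminus X$, and $\eta_G(X)=|\mathrm{mid}(X)|$; $\mathrm{bw}(G)$ is the $\eta_G$-branch-width on $E(G)$. Mim-width $\mathrm{mimw}(G)$: for $X\subseteq V(G)$, $\mathrm{cutmim}_G(X)$ is the maximum size of an induced matching in the bipartite graph consisting of the edges of $G$ with one end in $X$ and the other in $V(G)\setminus X$; $\mathrm{mimw}(G)$ is the $\mathrm{cutmim}_G$-branch-width on $V(G)$. *)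

theory Defs
  imports Complex_Main
begin

datatype 'a ugraph = UGraph (verts: "'a set") (edges: "'a set set")

definition finite_simple_graph :: "'a ugraph \<Rightarrow> bool" where
  "finite_simple_graph G \<longleftrightarrow>
     finite (verts G) \<and> (\<forall>e\<in>edges G. e \<subseteq> verts G \<and> card e = 2)"

definition adjacent :: "'a ugraph \<Rightarrow> 'a \<Rightarrow> 'a \<Rightarrow> bool" where
  "adjacent G u v \<longleftrightarrow> {u, v} \<in> edges G"

definition degree :: "'a ugraph \<Rightarrow> 'a \<Rightarrow> nat" where
  "degree G v = card {e \<in> edges G. v \<in> e}"

definition delete_edge :: "'a ugraph \<Rightarrow> 'a set \<Rightarrow> 'a ugraph" where
  "delete_edge G e = UGraph (verts G) (edges G - {e})"

definition induced_subgraph :: "'a ugraph \<Rightarrow> 'a set \<Rightarrow> 'a ugraph" where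
  "induced_subgraph G U = UGraph (verts G \<inter> U) {e \<in> edges G. e \<subseteq> U}"

definition line_graph :: "'a ugraph \<Rightarrow> 'a set ugraph" where
  "line_graph G =
     UGraph (edges G) {{e, f} | e f. e \<in> edges G \<and> f \<in> edges G \<and> e \<noteq> f \<and> e \<inter> f \<noteq> {}}"

subsection \<open>Trees\<close>

definition component_of :: "'a ugraph \<Rightarrow> 'a \<Rightarrow> 'a set" where
  "component_of G u = {v \<in> verts G. (adjacent G)\<^sup>*\<^sup>* u v}"

definition components :: "'a ugraph \<Rightarrow> 'a set set" where
  "components G = component_of G ` verts G"

definition connected_graph :: "'a ugraph \<Rightarrow> bool" where
  "connected_graph G \<longleftrightarrow>
     verts G \<noteq> {} \<and> (\<forall>u\<in>verts G. \<forall>v\<in>verts G. (adjacent G)\<^sup>*\<^sup>* u v)"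

text \<open>A cycle is given by the list of its vertices in cyclic order, without repeating the first.\<close>

definition is_cycle :: "'a ugraph \<Rightarrow> 'a list \<Rightarrow> bool" where
  "is_cycle G c \<longleftrightarrow>
     length c \<ge> 3 \<and> distinct c \<and> successively (adjacent G) c \<and> adjacent G (last c) (hd c)"

definition is_tree :: "'a ugraph \<Rightarrow> bool" where
  "is_tree T \<longleftrightarrow> finite_simple_graph T \<and> connected_graph T \<and> (\<nexists>c. is_cycle T c)"

definition leaves :: "'a ugraph \<Rightarrow> 'a set" where
  "leaves T = {v \<in> verts T. degree T v = 1}"

subsection \<open>Branch-width of a set function\<close>

text \<open>The nodes of the tree are natural numbers: every finite tree is isomorphic to such a tree,
  so this does not restrict the minimum in the definition of branch-width.\<close>

definition branch_decomposition :: "'a set \<Rightarrow> nat ugraph \<Rightarrow> ('a \<Rightarrow> nat) \<Rightarrow> bool" where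
  "branch_decomposition S T \<delta> \<longleftrightarrow>
     is_tree T \<and> (\<forall>v\<in>verts T. degree T v \<le> 3) \<and> bij_betw \<delta> S (leaves T)"

text \<open>The maximum ranges over both parts of the bipartition of \<open>S\<close> induced by an edge;
  for functions satisfying \<open>f X = f (S - X)\<close> the two parts have the same value.\<close>

definition decomposition_width ::
    "('a set \<Rightarrow> int) \<Rightarrow> 'a set \<Rightarrow> nat ugraph \<Rightarrow> ('a \<Rightarrow> nat) \<Rightarrow> int" where
  "decomposition_width f S T \<delta> =
     Max {f {x \<in> S. \<delta> x \<in> C} | e C. e \<in> edges T \<and> C \<in> components (delete_edge T e)}"

definition f_branch_width :: "('a set \<Rightarrow> int) \<Rightarrow> 'a set \<Rightarrow> int" where
  "f_branch_width f S =
     (if card S \<ge> 2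
      then Min {decomposition_width f S T \<delta> | T \<delta>. branch_decomposition S T \<delta>}
      else f {})"

subsection \<open>Branch-width of a graph\<close>

definition mid :: "'a ugraph \<Rightarrow> 'a set set \<Rightarrow> 'a set" where
  "mid G X = {v \<in> verts G. (\<exists>e\<in>X. v \<in> e) \<and> (\<exists>e\<in>edges G - X. v \<in> e)}"

definition eta :: "'a ugraph \<Rightarrow> 'a set set \<Rightarrow> int" where
  "eta G X = int (card (mid G X))"

definition bw :: "'a ugraph \<Rightarrow> int" where
  "bw G = f_branch_width (eta G) (edges G)"

subsection \<open>Mim-width of a graph\<close>

definition matching :: "'a ugraph \<Rightarrow> 'a set set \<Rightarrow> bool" where
  "matching G M \<longleftrightarrow> M \<subseteq> edges G \<and> (\<forall>e\<in>M. \<forall>f\<in>M. e \<noteq> f \<longrightarrow> e \<inter> f = {})"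

definition induced_matching :: "'a ugraph \<Rightarrow> 'a set set \<Rightarrow> bool" where
  "induced_matching G M \<longleftrightarrow> matching G M \<and> edges (induced_subgraph G (\<Union>M)) = M"

definition cut_graph :: "'a ugraph \<Rightarrow> 'a set \<Rightarrow> 'a ugraph" where
  "cut_graph G X =
     UGraph (verts G) {{u, v} | u v. {u, v} \<in> edges G \<and> u \<in> X \<and> v \<in> verts G - X}"

definition cutmim :: "'a ugraph \<Rightarrow> 'a set \<Rightarrow> int" where
  "cutmim G X = Max {int (card M) | M. induced_matching (cut_graph G X) M}"

definition mimw :: "'a ugraph \<Rightarrow> int" where
  "mimw G = f_branch_width (cutmim G) (verts G)"

subsection \<open>Symmetry of the two set functions\<close>

lemma eta_symmetric: "X \<subseteq> edges G \<Longrightarrow> eta G (edges G - X) = eta G X"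
proof -
  assume "X \<subseteq> edges G"
  then have "mid G (edges G - X) = mid G X"
    by (auto simp: mid_def double_diff)
  then show ?thesis by (simp add: eta_def)
qed

lemma cutmim_symmetric: "X \<subseteq> verts G \<Longrightarrow> cutmim G (verts G - X) = cutmim G X"
proof -
  assume "X \<subseteq> verts G"
  then have "verts G - (verts G - X) = X" by (rule double_diff) simp
  moreover have "{{u, v} | u v. {u, v} \<in> edges G \<and> u \<in> A \<and> v \<in> B} =
      {{u, v} | u v. {u, v} \<in> edges G \<and> u \<in> B \<and> v \<in> A}" for A B
    by (metis (no_types, opaque_lifting) insert_commute)
  ultimately have "cut_graph G (verts G - X) = cut_graph G X"
    by (simp add: cut_graph_def del: Diff_iff)
  then show ?thesis by (simp add: cutmim_def)
qed

end

theory Submission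
  imports Defs
begin

text \<open>Both widths range over the branch decompositions of the same ground set \<open>E(G) = V(L(G))\<close>,
  so it suffices to compare the two set functions on a single \<open>X \<subseteq> E(G)\<close>.
  Each edge \<open>{e, f}\<close> of an induced matching in the cut of \<open>L(G)\<close> has a common vertex of \<open>e\<close> and
  \<open>f\<close> in \<open>mid X\<close>, and inducedness makes these vertices distinct; hence \<open>cutmim X \<le> \<eta> X\<close>.
  Conversely choose at every \<open>v \<in> mid X\<close> an edge \<open>{v, x v} \<in> X\<close> and an edge
  \<open>{v, y v} \<notin> X\<close>. The digraph with arcs \<open>v \<rightarrow> x v\<close> and \<open>v \<rightarrow> y v\<close> has out-degree at most 2, hence
  an independent set containing a fifth of \<open>mid X\<close>; averaging over all vertex sets \<open>R\<close>, some \<open>R\<close>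
  satisfies \<open>x v \<in> R\<close> and \<open>y v \<notin> R\<close> for a quarter of it. The chosen edges at the remaining vertices
  form an induced matching, so even \<open>\<eta> X \<le> 20 cutmim X\<close>.\<close>

subsection \<open>Existence of branch decompositions\<close>

text \<open>Encoding by parent pointers: \<open>0\<close> is the root and every other node indexes
  the edge to its parent. A tree is then specified by any \<open>p\<close> with
  \<open>p v < v\<close>.\<close>

definition parent_graph :: "nat \<Rightarrow> (nat \<Rightarrow> nat) \<Rightarrow> nat ugraph" where
  "parent_graph N p = UGraph {..<N} {{v, p v} | v. 0 < v \<and> v < N}"

lemma verts_parent_graph [simp]: "verts (parent_graph N p) = {..<N}"
  by (simp add: parent_graph_def)

lemma edges_parent_graph: "edges (parent_graph N p) = {{v, p v} | v. 0 < v \<and> v < N}"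
  by (simp add: parent_graph_def)

lemma adjacent_sym: "adjacent G u v \<longleftrightarrow> adjacent G v u"
  by (simp add: adjacent_def insert_commute)

text \<open>The cyclic successor and predecessor of \<open>m\<close> are distinct because a cycle
  has length at least 3.\<close>

lemma cycle_two_neighbours:
  assumes "is_cycle G c" "m \<in> set c"
  shows "\<exists>u w. u \<in> set c \<and> w \<in> set c \<and> u \<noteq> w \<and> adjacent G m u \<and> adjacent G m w"
proof -
  have len: "length c \<ge> 3" and dist: "distinct c"
    and succ: "\<And>i. Suc i < length c \<Longrightarrow> adjacent G (c ! i) (c ! Suc i)"
    and wrap: "adjacent G (c ! (length c - 1)) (c ! 0)"
    using assms
    by (auto simp: is_cycle_def successively_conv_nth last_conv_nth hd_conv_nth in_set_conv_nth
        simp flip: length_greater_0_conv)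
  obtain i where i: "i < length c" "m = c ! i"
    using assms(2) by (auto simp: in_set_conv_nth)
  define j where "j = (if Suc i < length c then Suc i else 0)"
  define k where "k = (if i = 0 then length c - 1 else i - 1)"
  have "adjacent G m (c ! j)"
  proof (cases "Suc i < length c")
    case False
    then have "i = length c - 1" using i by simp
    then show ?thesis using wrap i False by (simp add: j_def)
  qed (use succ i in \<open>simp add: j_def\<close>)
  moreover have "adjacent G (c ! k) m"
    using succ[of "i - 1"] wrap i by (cases "i = 0") (simp_all add: k_def)
  then have "adjacent G m (c ! k)" by (simp only: adjacent_sym)
  moreover have jk: "j < length c" "k < length c" "j \<noteq> k"
    using len i by (auto simp: j_def k_def)
  ultimately show ?thesis
    using dist by (metis nth_eq_iff_index_eq nth_mem)
qed

text \<open>Following parents descends to \<open>0\<close>, which gives connectedness. The largest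
  vertex of a cycle would have two smaller neighbours, but its only smaller neighbour is its
  parent.\<close>

lemma is_tree_parent_graph:
  assumes N: "0 < N" and p: "\<And>v. 0 < v \<Longrightarrow> v < N \<Longrightarrow> p v < v"
  shows "is_tree (parent_graph N p)"
  unfolding is_tree_def
proof (intro conjI)
  let ?T = "parent_graph N p"
  have "card {v, p v} = 2" if "0 < v" "v < N" for v
    using p[OF that] by simp
  moreover have "{v, p v} \<subseteq> {..<N}" if "0 < v" "v < N" for v
    using p[OF that] that by simp
  ultimately show "finite_simple_graph ?T"
    unfolding finite_simple_graph_def edges_parent_graph verts_parent_graph by blast
  have "(adjacent ?T)\<^sup>*\<^sup>* v 0" if "v < N" for v
    using that
  proof (induction v rule: less_induct)
    case (less v)
    show ?case
    proof (cases "v = 0")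
      case False
      then have "adjacent ?T v (p v)"
        using less.prems by (auto simp: adjacent_def edges_parent_graph)
      moreover have "(adjacent ?T)\<^sup>*\<^sup>* (p v) 0"
        using less.IH[of "p v"] p[of v] False less.prems by simp
      ultimately show ?thesis by (rule converse_rtranclp_into_rtranclp)
    qed simp
  qed
  moreover have "symp (adjacent ?T)\<^sup>*\<^sup>*"
    by (intro symp_rtranclp sympI) (simp add: adjacent_sym)
  ultimately have "(adjacent ?T)\<^sup>*\<^sup>* u v" if "u < N" "v < N" for u v
    using that by (meson rtranclp_trans sympD)
  then show "connected_graph ?T"
    using N by (auto simp: connected_graph_def)
  have adj: "u = p v" if uv: "adjacent ?T v u" "u \<le> v" for u v
  proof -
    obtain w where w: "{v, u} = {w, p w}" "0 < w" "w < N"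
      using uv(1) by (auto simp: adjacent_def edges_parent_graph)
    with p[of w] uv(2) show ?thesis by (auto simp: doubleton_eq_iff)
  qed
  show "\<nexists>c. is_cycle ?T c"
  proof
    assume "\<exists>c. is_cycle ?T c"
    then obtain c where c: "is_cycle ?T c" by blast
    then have "set c \<noteq> {}" by (auto simp: is_cycle_def)
    then have "Max (set c) \<in> set c" by simp
    from cycle_two_neighbours[OF c this] show False
      using adj by (metis List.finite_set Max_ge)
  qed
qed

text \<open>The tree is a binary heap with nodes \<open>1, \<dots>, 2n - 3\<close>, together with an extra leaf \<open>0\<close>
  attached to the root \<open>1\<close>.\<close>

lemma branch_decomposition_exists:
  assumes "card S \<ge> 2"
  shows "\<exists>T \<delta>. branch_decomposition S T \<delta>"
proof -
  define n where "n = card S"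
  define T where "T = parent_graph (2 * n - 2) (\<lambda>v. v div 2)"
  have n: "n \<ge> 2" and fin: "finite S"
    using assms card.infinite[of S] by (cases "finite S"; simp add: n_def)+
  have edges: "edges T = {{v, v div 2} | v. 0 < v \<and> v < 2 * n - 2}"
    and verts: "verts T = {..<2 * n - 2}"
    by (simp_all add: T_def edges_parent_graph)
  have tree: "is_tree T"
    unfolding T_def using n by (intro is_tree_parent_graph) auto
  have inc: "{e \<in> edges T. v \<in> e} =
      (\<lambda>u. {u, u div 2}) ` {u. 0 < u \<and> u < 2 * n - 2 \<and> (u = v \<or> u div 2 = v)}" for v
    by (auto simp: edges)
  \<comment> \<open>Each edge is indexed by its larger end \<open>u\<close>, so the degree of
    \<open>v\<close> counts \<open>v\<close> itself (if positive) and its children.\<close>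
  have inj: "inj_on (\<lambda>u::nat. {u, u div 2}) {u. 0 < u}"
    by (auto simp: inj_on_def doubleton_eq_iff)
  have deg: "degree T v = card {u. 0 < u \<and> u < 2 * n - 2 \<and> (u = v \<or> u div 2 = v)}" for v
    unfolding degree_def inc by (rule card_image) (rule inj_on_subset[OF inj], auto)
  \<comment> \<open>A positive node \<open>v\<close> has both children \<open>2 * v\<close> and
    \<open>2 * v + 1\<close> in range if \<open>v < n - 1\<close>, and none otherwise. The only
    child of \<open>0\<close> is \<open>1\<close>.\<close>
  have deg_inner: "degree T v = 3" if "0 < v" "v < n - 1" for v
  proof -
    have "{u. 0 < u \<and> u < 2 * n - 2 \<and> (u = v \<or> u div 2 = v)} = {v, 2 * v, 2 * v + 1}"
      using that by auto
    then show ?thesis using that by (simp add: deg)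
  qed
  have deg_outer: "degree T v = 1" if "n - 1 \<le> v" "v < 2 * n - 2" for v
  proof -
    have "{u. 0 < u \<and> u < 2 * n - 2 \<and> (u = v \<or> u div 2 = v)} = {v}"
      using that n by auto
    then show ?thesis by (simp add: deg)
  qed
  have deg_0: "degree T 0 = 1"
  proof -
    have "{u::nat. 0 < u \<and> u < 2 * n - 2 \<and> (u = 0 \<or> u div 2 = 0)} = {1}"
      using n by auto
    then show ?thesis by (simp add: deg)
  qed
  have "degree T v \<le> 3" if "v \<in> verts T" for v
    using deg_0 deg_inner[of v] deg_outer[of v] that
    by (cases "v = 0"; cases "v < n - 1") (auto simp: verts)
  moreover have "leaves T = insert 0 {n - 1..<2 * n - 2}"
  proof (rule set_eqI)
    fix v
    show "v \<in> leaves T \<longleftrightarrow> v \<in> insert 0 {n - 1..<2 * n - 2}"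
      using deg_0 deg_inner[of v] deg_outer[of v] n
      by (cases "v = 0"; cases "v < n - 1") (auto simp: verts leaves_def)
  qed
  \<comment> \<open>The \<open>n - 1\<close> nodes without children and the extra leaf
    \<open>0\<close> make \<open>n\<close> leaves.\<close>
  then have "finite (leaves T)" "card (leaves T) = card S"
    using n by (auto simp: n_def[symmetric])
  then obtain \<delta> where "bij_betw \<delta> S (leaves T)"
    using fin by (metis finite_same_card_bij)
  ultimately show ?thesis
    using tree by (auto simp: branch_decomposition_def)
qed

subsection \<open>Comparison of branch-widths\<close>

text \<open>The family \<open>P\<close> does not depend on \<open>f\<close>, so two set functions
  can be compared on the same parts; being finite and nonempty, it makes each \<open>Max\<close>
  attained.\<close>

lemma decomposition_values:
  assumes "finite S" "card S \<ge> 2" "branch_decomposition S T \<delta>"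
  defines "P \<equiv> {{x \<in> S. \<delta> x \<in> C} | e C. e \<in> edges T \<and> C \<in> components (delete_edge T e)}"
  shows "decomposition_width f S T \<delta> = Max (f ` P)" "finite P" "P \<noteq> {}" "P \<subseteq> Pow S"
proof -
  have "{f {x \<in> S. \<delta> x \<in> C} | e C. e \<in> edges T \<and> C \<in> components (delete_edge T e)} = f ` P"
    by (auto simp: P_def)
  then show "decomposition_width f S T \<delta> = Max (f ` P)"
    by (simp add: decomposition_width_def)
  show "P \<subseteq> Pow S" by (auto simp: P_def)
  then show "finite P" using assms(1) by (meson finite_Pow_iff finite_subset)
  have "S \<noteq> {}" using assms(2) by auto
  then obtain v where "v \<in> leaves T"
    using assms(3) by (auto simp: branch_decomposition_def bij_betw_def)
  then have "degree T v = 1" "v \<in> verts T" by (auto simp: leaves_def)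
  then obtain e where "e \<in> edges T"
    unfolding degree_def by (metis (no_types, lifting) card_1_singletonE insertI1 mem_Collect_eq)
  moreover have "component_of (delete_edge T e) v \<in> components (delete_edge T e)"
    using \<open>v \<in> verts T\<close> by (simp add: components_def delete_edge_def)
  ultimately show "P \<noteq> {}" by (auto simp: P_def)
qed

text \<open>A decomposition optimal for \<open>g\<close> is also a candidate for \<open>f\<close>,
  and the inequality holds on each of its parts.\<close>

lemma f_branch_width_le_scaled:
  fixes c :: int
  assumes "finite S" "0 \<le> c" and le: "\<And>X. X \<subseteq> S \<Longrightarrow> f X \<le> c * g X"
  shows "f_branch_width f S \<le> c * f_branch_width g S"
proof (cases "card S \<ge> 2")
  case True
  define W where "W h = {decomposition_width h S T \<delta> | T \<delta>. branch_decomposition S T \<delta>}" for h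
  \<comment> \<open>There may be infinitely many decompositions, but every width is a value of
    \<open>h\<close> on a subset of \<open>S\<close>.\<close>
  have fin: "finite (W h)" for h
  proof (rule finite_subset)
    show "W h \<subseteq> h ` Pow S"
    proof
      fix w assume "w \<in> W h"
      then obtain T \<delta> where w: "w = decomposition_width h S T \<delta>" "branch_decomposition S T \<delta>"
        by (auto simp: W_def)
      note P = decomposition_values[OF assms(1) True w(2)]
      show "w \<in> h ` Pow S"
        unfolding w(1) P(1)[of h] using P(2-4) Max_in[of "h ` _"] by blast
    qed
    show "finite (h ` Pow S)" using assms(1) by simp
  qed
  have "W g \<noteq> {}"
    using branch_decomposition_exists[OF True] by (auto simp: W_def)
  then have "Min (W g) \<in> W g" using fin by simp
  then obtain T \<delta> where g: "Min (W g) = decomposition_width g S T \<delta>"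
    and bd: "branch_decomposition S T \<delta>"
    by (auto simp: W_def)
  note P = decomposition_values[OF assms(1) True bd]
  have "Min (W f) \<le> decomposition_width f S T \<delta>"
    using fin bd by (intro Min_le) (auto simp: W_def)
  also have "\<dots> \<le> c * decomposition_width g S T \<delta>"
    unfolding P(1)
  proof (rule Max.boundedI)
    fix z assume "z \<in> f ` {{x \<in> S. \<delta> x \<in> C} | e C. e \<in> edges T \<and> C \<in> components (delete_edge T e)}"
    then obtain X where X: "z = f X"
      "X \<in> {{x \<in> S. \<delta> x \<in> C} | e C. e \<in> edges T \<and> C \<in> components (delete_edge T e)}"
      by blast
    have "f X \<le> c * g X" using X(2) P(4) by (intro le) blast
    also have "\<dots> \<le> c * Max (g ` {{x \<in> S. \<delta> x \<in> C} | e C.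
        e \<in> edges T \<and> C \<in> components (delete_edge T e)})"
      using X(2) P(2) assms(2) by (intro mult_left_mono Max_ge) auto
    finally show "z \<le> \<dots>" using X(1) by simp
  qed (use P in auto)
  finally show ?thesis
    using True g by (simp add: f_branch_width_def W_def)
next
  case False
  then show ?thesis using le[of "{}"] by (simp add: f_branch_width_def)
qed

subsection \<open>Two extremal lemmas\<close>

text \<open>Greedy choice: out-degrees are at most 2, so some \<open>w\<close> has in-degree at most
  2. Select \<open>w\<close>, delete it with its in- and out-neighbours, and recurse.\<close>

lemma independent_set_out_degree_two:
  fixes x y :: "'a \<Rightarrow> 'a"
  assumes "finite A"
  shows "\<exists>S\<subseteq>A. card A \<le> 5 * card S \<and>
    (\<forall>v\<in>S. \<forall>w\<in>S. v \<noteq> w \<longrightarrow> x v \<noteq> w \<and> y v \<noteq> w)"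
  using assms
proof (induction A rule: finite_psubset_induct)
  case (psubset A)
  show ?case
  proof (cases "A = {}")
    case False
    define I where "I w = {v \<in> A. x v = w \<or> y v = w}" for w
    have "\<exists>w\<in>A. card (I w) \<le> 2"
    proof (rule ccontr)
      assume "\<not> ?thesis"
      \<comment> \<open>Count the pairs of \<open>v\<close> and a target \<open>w\<close> in two
        ways: in-degrees of at least 3 everywhere contradict out-degrees of at most 2.\<close>
      then have "(\<Sum>w\<in>A. 3) \<le> (\<Sum>w\<in>A. card (I w))"
        by (intro sum_mono) force
      also have "\<dots> = (\<Sum>w\<in>A. \<Sum>v\<in>A. if x v = w \<or> y v = w then 1 else 0)"
        using psubset.hyps by (simp add: I_def sum.If_cases Int_def)
      also have "\<dots> = (\<Sum>v\<in>A. \<Sum>w\<in>A. if x v = w \<or> y v = w then 1 else 0)"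
        by (rule sum.swap)
      also have "\<dots> \<le> (\<Sum>v\<in>A. 2)"
      proof (rule sum_mono)
        fix v
        have "(\<Sum>w\<in>A. if x v = w \<or> y v = w then 1 else 0) = card {w \<in> A. x v = w \<or> y v = w}"
          using psubset.hyps by (simp add: sum.If_cases Int_def)
        also have "\<dots> \<le> card {x v, y v}" by (rule card_mono) auto
        also have "\<dots> \<le> 2" by (simp add: card_insert_if)
        finally show "(\<Sum>w\<in>A. if x v = w \<or> y v = w then 1 else 0) \<le> (2::nat)" .
      qed
      finally show False using False psubset.hyps by (simp add: card_gt_0_iff)
    qed
    then obtain w where w: "w \<in> A" "card (I w) \<le> 2" by blast
    \<comment> \<open>At most 1 + 2 + 2 = 5 vertices are lost for each one selected.\<close>
    define N where "N = insert w (insert (x w) (insert (y w) (I w)))"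
    have "card N \<le> 5" and finN: "finite N"
      using w psubset.hyps by (auto simp: N_def I_def card_insert_if)
    have "A - N \<subset> A" using w by (auto simp: N_def)
    from psubset.IH[OF this] obtain S where S: "S \<subseteq> A - N" "card (A - N) \<le> 5 * card S"
      "\<forall>v\<in>S. \<forall>w\<in>S. v \<noteq> w \<longrightarrow> x v \<noteq> w \<and> y v \<noteq> w" by blast
    have "w \<notin> S" "finite S" using S(1) psubset.hyps finite_subset by (auto simp: N_def)
    then have "card A \<le> 5 * card (insert w S)"
      using S(2) \<open>card N \<le> 5\<close> diff_card_le_card_Diff[OF finN, of A] by simp
    moreover have "x v \<noteq> w \<and> y v \<noteq> w \<and> x w \<noteq> v \<and> y w \<noteq> v" if "v \<in> S" for v
      using that S(1) by (auto simp: N_def I_def)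
    ultimately show ?thesis
      using S w by (intro exI[of _ "insert w S"]) auto
  qed simp
qed

text \<open>For a uniformly random \<open>R\<close>, the event
  \<open>x v \<in> R \<and> y v \<notin> R\<close> has probability 1/4 since
  \<open>x v \<noteq> y v\<close>; some \<open>R\<close> reaches the average.\<close>

lemma separating_set_quarter:
  fixes x y :: "'a \<Rightarrow> 'b"
  assumes "finite S" and ne: "\<And>v. v \<in> S \<Longrightarrow> x v \<noteq> y v"
  shows "\<exists>R. card S \<le> 4 * card {v \<in> S. x v \<in> R \<and> y v \<notin> R}"
proof (rule ccontr)
  assume "\<not> ?thesis"
  then have less: "4 * card {v \<in> S. x v \<in> R \<and> y v \<notin> R} < card S" for R
    by (simp add: not_le)
  \<comment> \<open>Restricting \<open>R\<close> to subsets of the finite set \<open>U\<close> makes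
    the averaging a finite double count.\<close>
  define U where "U = x ` S \<union> y ` S"
  have finU: "finite U" using assms(1) by (simp add: U_def)
  have count: "4 * card {R \<in> Pow U. x v \<in> R \<and> y v \<notin> R} = 2 ^ card U" if v: "v \<in> S" for v
  proof -
    have "{R \<in> Pow U. x v \<in> R \<and> y v \<notin> R} = insert (x v) ` Pow (U - {x v, y v})"
    proof (intro equalityI subsetI)
      fix R assume "R \<in> {R \<in> Pow U. x v \<in> R \<and> y v \<notin> R}"
      then have "R = insert (x v) (R - {x v})" "R - {x v} \<in> Pow (U - {x v, y v})" by auto
      then show "R \<in> insert (x v) ` Pow (U - {x v, y v})" by blast
    qed (use v ne[OF v] in \<open>auto simp: U_def\<close>)
    moreover have "inj_on (insert (x v)) (Pow (U - {x v, y v}))"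
      by (auto simp: inj_on_def)
    ultimately have "card {R \<in> Pow U. x v \<in> R \<and> y v \<notin> R} = 2 ^ card (U - {x v, y v})"
      using finU by (simp add: card_image card_Pow)
    moreover have "{x v, y v} \<subseteq> U" using v by (auto simp: U_def)
    then have "card U = card (U - {x v, y v}) + 2"
      using ne[OF v] finU card_mono[of U "{x v, y v}"] by (simp add: card_Diff_subset)
    ultimately show ?thesis by simp
  qed
  have "(\<Sum>R\<in>Pow U. 4 * card {v \<in> S. x v \<in> R \<and> y v \<notin> R})
      = 4 * (\<Sum>R\<in>Pow U. \<Sum>v\<in>S. if x v \<in> R \<and> y v \<notin> R then 1 else 0)"
    using assms(1) by (simp add: sum.If_cases Int_def sum_distrib_left)
  also have "\<dots> = 4 * (\<Sum>v\<in>S. \<Sum>R\<in>Pow U. if x v \<in> R \<and> y v \<notin> R then 1 else 0)"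
    by (subst sum.swap) (rule refl)
  also have "\<dots> = (\<Sum>v\<in>S. 4 * card {R \<in> Pow U. x v \<in> R \<and> y v \<notin> R})"
    using finU by (simp add: sum.If_cases Int_def sum_distrib_left)
  also have "\<dots> = (\<Sum>v\<in>S. 2 ^ card U)" by (rule sum.cong[OF refl count])
  also have "\<dots> = (\<Sum>R\<in>Pow U. card S)" using finU by (simp add: card_Pow)
  finally have "(\<Sum>R\<in>Pow U. 4 * card {v \<in> S. x v \<in> R \<and> y v \<notin> R}) = (\<Sum>R\<in>Pow U. card S)" .
  moreover have "(\<Sum>R\<in>Pow U. 4 * card {v \<in> S. x v \<in> R \<and> y v \<notin> R}) < (\<Sum>R\<in>Pow U. card S)"
    using less finU by (intro sum_strict_mono) auto
  ultimately show False by simp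
qed

text \<open>The factor is 20 = 5 * 4. One common \<open>R\<close> contains every \<open>x v\<close>
  and no \<open>y w\<close>, which separates them for all pairs, not only for
  \<open>v = w\<close>.\<close>

lemma conflict_free_subset:
  fixes x y :: "'a \<Rightarrow> 'a"
  assumes "finite A" "\<And>v. v \<in> A \<Longrightarrow> x v \<noteq> y v"
  shows "\<exists>S\<subseteq>A. card A \<le> 20 * card S \<and>
    (\<forall>v\<in>S. \<forall>w\<in>S. x v \<noteq> y w \<and> (v \<noteq> w \<longrightarrow> x v \<noteq> w \<and> y v \<noteq> w))"
proof -
  obtain B where B: "B \<subseteq> A" "card A \<le> 5 * card B"
    "\<forall>v\<in>B. \<forall>w\<in>B. v \<noteq> w \<longrightarrow> x v \<noteq> w \<and> y v \<noteq> w"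
    using independent_set_out_degree_two[OF assms(1), of x y] by blast
  obtain R where R: "card B \<le> 4 * card {v \<in> B. x v \<in> R \<and> y v \<notin> R}"
    using separating_set_quarter[of B x y] B(1) assms finite_subset by blast
  show ?thesis
    using B R by (intro exI[of _ "{v \<in> B. x v \<in> R \<and> y v \<notin> R}"]) auto
qed

subsection \<open>Comparison of the two set functions\<close>

lemma edges_cut_line_graph:
  "edges (cut_graph (line_graph G) X) =
    {{e, f} | e f. e \<in> edges G \<and> f \<in> edges G \<and> e \<in> X \<and> f \<notin> X \<and> e \<inter> f \<noteq> {}}"
  by (auto simp: cut_graph_def line_graph_def doubleton_eq_iff) blast+

lemma finite_edges: "finite_simple_graph G \<Longrightarrow> finite (edges G)"
  unfolding finite_simple_graph_def by (meson PowI finite_Pow_iff finite_subset subsetI)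

lemma finite_induced_matchings:
  assumes "finite_simple_graph G"
  shows "finite {int (card M) | M. induced_matching (cut_graph (line_graph G) X) M}"
proof -
  have "edges (cut_graph (line_graph G) X) \<subseteq> Pow (edges G)"
    by (auto simp: edges_cut_line_graph)
  then have "{M. induced_matching (cut_graph (line_graph G) X) M} \<subseteq> Pow (Pow (edges G))"
    by (auto simp: induced_matching_def matching_def)
  then have "finite {M. induced_matching (cut_graph (line_graph G) X) M}"
    using finite_edges[OF assms] by (meson finite_Pow_iff finite_subset)
  then show ?thesis by simp
qed

lemma cutmim_line_graph_le_eta:
  assumes "finite_simple_graph G"
  shows "cutmim (line_graph G) X \<le> eta G X"
  unfolding cutmim_def
proof (rule Max.boundedI)
  let ?H = "cut_graph (line_graph G) X"
  show "finite {int (card M) | M. induced_matching ?H M}"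
    by (rule finite_induced_matchings[OF assms])
  have "induced_matching ?H {}"
    by (auto simp: induced_matching_def matching_def induced_subgraph_def edges_cut_line_graph)
  then show "{int (card M) | M. induced_matching ?H M} \<noteq> {}" by blast
  fix k assume "k \<in> {int (card M) | M. induced_matching ?H M}"
  then obtain M where k: "k = int (card M)" and M: "induced_matching ?H M" by blast
  have sub: "M \<subseteq> edges ?H" and disj: "\<And>a b. a \<in> M \<Longrightarrow> b \<in> M \<Longrightarrow> a \<inter> b \<noteq> {} \<Longrightarrow> a = b"
    using M unfolding induced_matching_def matching_def by blast+
  have M_eq: "{a \<in> edges ?H. a \<subseteq> \<Union>M} = M"
    using M by (simp add: induced_matching_def induced_subgraph_def)
  have "\<exists>e f v. m = {e, f} \<and> e \<in> edges G \<inter> X \<and> f \<in> edges G - X \<and> v \<in> e \<inter> f"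
    if m: "m \<in> M" for m
  proof -
    have "m \<in> edges ?H" using m sub by blast
    then obtain e f where
      "m = {e, f}" "e \<in> edges G" "f \<in> edges G" "e \<in> X" "f \<notin> X" "e \<inter> f \<noteq> {}"
      unfolding edges_cut_line_graph by (elim CollectE exE conjE) (rule that)
    then show ?thesis by blast
  qed
  \<comment> \<open>Orient each matching edge: \<open>e m\<close> is its end in \<open>X\<close>,
    \<open>f m\<close> its end outside, and \<open>v m\<close> a vertex of \<open>G\<close> common
    to both.\<close>
  then obtain e f v where m_eq: "\<And>m. m \<in> M \<Longrightarrow> m = {e m, f m}"
    and e: "\<And>m. m \<in> M \<Longrightarrow> e m \<in> edges G \<inter> X"
    and f: "\<And>m. m \<in> M \<Longrightarrow> f m \<in> edges G - X"
    and v: "\<And>m. m \<in> M \<Longrightarrow> v m \<in> e m \<inter> f m"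
    by metis
  have mem: "e m \<in> m" "f m \<in> m" if "m \<in> M" for m
    by (subst (2) m_eq[OF that], simp)+
  have "inj_on v M"
  proof (rule inj_onI)
    fix m m' assume m: "m \<in> M" "m' \<in> M" "v m = v m'"
    \<comment> \<open>A shared vertex makes \<open>e m\<close> and \<open>f m'\<close> adjacent
      across the cut. Inducedness puts this edge into \<open>M\<close>, where it meets both
      \<open>m\<close> and \<open>m'\<close>, so all three coincide.\<close>
    have "v m \<in> e m \<inter> f m'" using v[OF m(1)] v[OF m(2)] m(3) by simp
    then have "{e m, f m'} \<in> edges ?H"
      using e[OF m(1)] f[OF m(2)] unfolding edges_cut_line_graph by blast
    moreover have "{e m, f m'} \<subseteq> \<Union>M" using m mem by blast
    ultimately have "{e m, f m'} \<in> {a \<in> edges ?H. a \<subseteq> \<Union>M}" by simp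
    then have "{e m, f m'} \<in> M" unfolding M_eq .
    then have "m = {e m, f m'}" "m' = {e m, f m'}"
      using disj[OF m(1)] disj[OF m(2)] mem(1)[OF m(1)] mem(2)[OF m(2)] by blast+
    then show "m = m'" by simp
  qed
  moreover have "v ` M \<subseteq> mid G X"
  proof safe
    fix m assume "m \<in> M"
    from e[OF this] f[OF this] v[OF this] show "v m \<in> mid G X"
      using assms unfolding mid_def finite_simple_graph_def by blast
  qed
  moreover have "finite (mid G X)"
    using assms by (simp add: mid_def finite_simple_graph_def)
  ultimately have "card M \<le> card (mid G X)" by (rule card_inj_on_le)
  then show "k \<le> eta G X" by (simp add: k eta_def)
qed

lemma finite_simple_graph_other_end:
  assumes "finite_simple_graph G" "e \<in> edges G" "v \<in> e"
  shows "\<exists>u. e = {v, u} \<and> u \<noteq> v"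
proof -
  have "card e = 2" using assms by (auto simp: finite_simple_graph_def)
  then show ?thesis using assms(3) by (auto simp: card_2_iff)
qed

lemma eta_le_cutmim_line_graph:
  assumes G: "finite_simple_graph G" and X: "X \<subseteq> edges G"
  shows "eta G X \<le> 20 * cutmim (line_graph G) X"
proof -
  let ?H = "cut_graph (line_graph G) X"
  have "\<exists>u w. {v, u} \<in> X \<and> u \<noteq> v \<and> {v, w} \<in> edges G - X \<and> w \<noteq> v" if v: "v \<in> mid G X" for v
  proof -
    obtain a b where ab: "a \<in> X" "v \<in> a" "b \<in> edges G - X" "v \<in> b"
      using v unfolding mid_def by blast
    then obtain u w where "a = {v, u}" "u \<noteq> v" "b = {v, w}" "w \<noteq> v"
      using finite_simple_graph_other_end[OF G] X by (metis Diff_iff subsetD)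
    then show ?thesis using ab by blast
  qed
  then obtain x y where xy: "\<And>v. v \<in> mid G X \<Longrightarrow>
      {v, x v} \<in> X \<and> x v \<noteq> v \<and> {v, y v} \<in> edges G - X \<and> y v \<noteq> v"
    by metis
  have "finite (mid G X)" using G by (simp add: mid_def finite_simple_graph_def)
  moreover have "x v \<noteq> y v" if "v \<in> mid G X" for v using xy[OF that] by auto
  ultimately obtain S where S: "S \<subseteq> mid G X" "card (mid G X) \<le> 20 * card S"
    and free: "\<And>v w. v \<in> S \<Longrightarrow> w \<in> S \<Longrightarrow> x v \<noteq> y w \<and> (v \<noteq> w \<longrightarrow> x v \<noteq> w \<and> y v \<noteq> w)"
    using conflict_free_subset[of "mid G X" x y] by blast
  \<comment> \<open>The two edges chosen at \<open>v\<close>, on opposite sides of the cut.\<close>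
  define r where "r v = {v, x v}" for v
  define b where "b v = {v, y v}" for v
  have r: "r v \<in> X" "r v \<in> edges G" and b: "b v \<notin> X" "b v \<in> edges G" if "v \<in> S" for v
    using xy[of v] that S(1) X by (auto simp: r_def b_def)
  have rb: "r v \<noteq> b w" if "v \<in> S" "w \<in> S" for v w
    using r[OF that(1)] b[OF that(2)] by auto
  have r_eq: "v = w" if "v \<in> S" "w \<in> S" "r v = r w" for v w
    using that free[of v w] by (auto simp: r_def doubleton_eq_iff)
  have b_eq: "v = w" if "v \<in> S" "w \<in> S" "b v = b w" for v w
    using that free[of v w] by (auto simp: b_def doubleton_eq_iff)
  \<comment> \<open>For \<open>v \<noteq> w\<close> a common end would mean \<open>v = y w\<close>,
    \<open>x v = w\<close> or \<open>x v = y w\<close>, all excluded by \<open>free\<close>.\<close>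
  have meet: "v = w" if "v \<in> S" "w \<in> S" "r v \<inter> b w \<noteq> {}" for v w
    using that free[of v w] free[of w v] by (auto simp: r_def b_def)
  define M where "M = (\<lambda>v. {r v, b v}) ` S"
  have M_edges: "M \<subseteq> edges ?H"
  proof
    fix m assume "m \<in> M"
    then obtain v where v: "v \<in> S" "m = {r v, b v}" by (auto simp: M_def)
    moreover have "r v \<inter> b v \<noteq> {}" by (auto simp: r_def b_def)
    ultimately show "m \<in> edges ?H"
      using r[OF v(1)] b[OF v(1)] by (auto simp: edges_cut_line_graph)
  qed
  have "matching ?H M"
    unfolding matching_def using M_edges
  proof (intro conjI ballI impI)
    fix m m' assume "m \<in> M" "m' \<in> M" "m \<noteq> m'"
    then obtain v w where "v \<in> S" "w \<in> S" "v \<noteq> w" "m = {r v, b v}" "m' = {r w, b w}"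
      by (auto simp: M_def)
    then show "m \<inter> m' = {}"
      using rb[of v w] rb[of w v] r_eq[of v w] b_eq[of v w] by auto
  qed
  \<comment> \<open>Inducedness: the end in \<open>X\<close> must be some \<open>r v\<close> and the
    other end some \<open>b w\<close>, and \<open>meet\<close> forces \<open>v = w\<close>.\<close>
  moreover have "a \<in> M" if a: "a \<in> edges ?H" "a \<subseteq> \<Union>M" for a
  proof -
    obtain e f where ef: "a = {e, f}" "e \<in> X" "f \<notin> X" "e \<inter> f \<noteq> {}"
      using a(1) by (auto simp: edges_cut_line_graph)
    have "e \<in> \<Union>M" "f \<in> \<Union>M" using a(2) ef(1) by auto
    then obtain v w where vw: "v \<in> S" "w \<in> S" "e = r v" "f = b w"
      using ef(2,3) r b by (auto simp: M_def)
    with meet ef(4) have "v = w" by blast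
    then show ?thesis using vw ef(1) by (simp add: M_def)
  qed
  ultimately have "induced_matching ?H M"
    using M_edges by (auto simp: induced_matching_def induced_subgraph_def)
  then have "int (card M) \<le> cutmim (line_graph G) X"
    unfolding cutmim_def using finite_induced_matchings[OF G]
    by (intro Max_ge) auto
  moreover have "inj_on (\<lambda>v. {r v, b v}) S"
    using rb r_eq by (auto simp: inj_on_def doubleton_eq_iff)
  then have "card M = card S" by (simp add: M_def card_image)
  ultimately show ?thesis using S(2) by (simp add: eta_def)
qed

theorem theorem1p4:
  fixes G :: "'a ugraph"
  assumes "finite_simple_graph G"
  shows "real_of_int (bw G) / 25 \<le> real_of_int (mimw (line_graph G))
    \<and> mimw (line_graph G) \<le> bw G"
proof -
  have V: "verts (line_graph G) = edges G" by (simp add: line_graph_def)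
  note fin = finite_edges[OF assms]
  have "mimw (line_graph G) \<le> bw G"
    unfolding mimw_def bw_def V
    using f_branch_width_le_scaled[OF fin, of 1 "cutmim (line_graph G)" "eta G"]
      cutmim_line_graph_le_eta[OF assms] by simp
  moreover have "bw G \<le> 25 * mimw (line_graph G)"
    unfolding mimw_def bw_def V
  proof (rule f_branch_width_le_scaled[OF fin])
    fix X assume "X \<subseteq> edges G"
    \<comment> \<open>Since \<open>eta G X\<close> is a cardinality, the bound with 20 shows that
      \<open>cutmim\<close> is nonnegative, so 20 may be raised to 25.\<close>
    from eta_le_cutmim_line_graph[OF assms this]
    show "eta G X \<le> 25 * cutmim (line_graph G) X" by (simp add: eta_def)
  qed simp
  ultimately show ?thesis by linarith
qed

end
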